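(* Let $n$ be a positive integer and $\varepsilon$ a real number with $0<\varepsilon\le \frac12-\frac1{2n}$ and $n\ge \frac{3}{\varepsilon}$. Then there exists a connected simple graph $G$ with $n$ vertices and $m$ edges such that (1) $h(G)\ge 3n-3-\sqrt{2m}$, and (2) $\varepsilon\le \frac{m}{n^2}\le \varepsilon+\frac1n+\frac{1}{2n^2}$.
   Context: A drawing of a graph $G$ in the plane represents vertices by distinct points and each edge by a simple continuous arc joining its endpoints, passing through no other vertex; any two edges share finitely many points, no two edges touch at an interior point, and no three edges share a common interior point. An edge is uncrossed in a drawing if it shares no interior point (crossing) with any other edge. The maximum uncrossed subgraph number $h(G)$ is the maximum, over all drawings of $G$ in the plane, of the number of uncrossed edges. *)

theory Defs
  imports "HOL-Analysis.Analysis"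
begin

definition simple_graph :: "'a set \<Rightarrow> 'a set set \<Rightarrow> bool" where
  "simple_graph V E \<longleftrightarrow> finite V \<and> (\<forall>e\<in>E. e \<subseteq> V \<and> card e = 2)"

definition connected_graph :: "'a set \<Rightarrow> 'a set set \<Rightarrow> bool" where
  "connected_graph V E \<longleftrightarrow> V \<noteq> {} \<and> (\<forall>u\<in>V. \<forall>v\<in>V. (u, v) \<in> {(x, y). {x, y} \<in> E}\<^sup>*)"

text \<open>The plane is the type \<^typ>\<open>complex\<close>.\<close>

definition arc_interior :: "(real \<Rightarrow> complex) \<Rightarrow> complex set" where
  "arc_interior g = path_image g - {pathstart g, pathfinish g}"

text \<open>Two curves cross at \<open>x\<close> if near \<open>x\<close> they look, up to a homeomorphism of the plane
  neighbourhood, like the two coordinate axes near the origin. They touch at a common interior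
  point if they do not cross there.\<close>

definition cross_at :: "(real \<Rightarrow> complex) \<Rightarrow> (real \<Rightarrow> complex) \<Rightarrow> complex \<Rightarrow> bool" where
  "cross_at g h x \<longleftrightarrow>
     (\<exists>U \<phi> \<psi>. open U \<and> x \<in> U \<and> homeomorphism U (ball 0 1) \<phi> \<psi> \<and> \<phi> x = (0::complex) \<and>
        \<phi> ` (U \<inter> path_image g) = {z \<in> ball 0 1. Im z = 0} \<and>
        \<phi> ` (U \<inter> path_image h) = {z \<in> ball 0 1. Re z = 0})"

definition touch_at :: "(real \<Rightarrow> complex) \<Rightarrow> (real \<Rightarrow> complex) \<Rightarrow> complex \<Rightarrow> bool" where
  "touch_at g h x \<longleftrightarrow> x \<in> arc_interior g \<inter> arc_interior h \<and> \<not> cross_at g h x"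

definition drawing ::
    "'a set \<Rightarrow> 'a set set \<Rightarrow> ('a \<Rightarrow> complex) \<Rightarrow> ('a set \<Rightarrow> real \<Rightarrow> complex) \<Rightarrow> bool" where
  "drawing V E p c \<longleftrightarrow>
     inj_on p V \<and>
     (\<forall>e\<in>E. arc (c e) \<and> {pathstart (c e), pathfinish (c e)} = p ` e \<and>
             path_image (c e) \<inter> p ` V \<subseteq> p ` e) \<and>
     (\<forall>e\<in>E. \<forall>f\<in>E. e \<noteq> f \<longrightarrow>
        finite (path_image (c e) \<inter> path_image (c f)) \<and> (\<nexists>x. touch_at (c e) (c f) x)) \<and>
     (\<forall>e\<in>E. \<forall>f\<in>E. \<forall>g\<in>E. e \<noteq> f \<and> e \<noteq> g \<and> f \<noteq> g \<longrightarrow>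
        arc_interior (c e) \<inter> arc_interior (c f) \<inter> arc_interior (c g) = {})"

definition uncrossed_edges :: "'a set set \<Rightarrow> ('a set \<Rightarrow> real \<Rightarrow> complex) \<Rightarrow> 'a set set" where
  "uncrossed_edges E c =
     {e \<in> E. \<forall>f\<in>E. f \<noteq> e \<longrightarrow> arc_interior (c e) \<inter> arc_interior (c f) = {}}"

definition max_uncrossed :: "'a set \<Rightarrow> 'a set set \<Rightarrow> nat" where
  "max_uncrossed V E = Max {card (uncrossed_edges E c) |p c. drawing V E p c}"

end

theory Submission
  imports Defs
begin

text \<open>
  Take a clique on \<open>k\<close> vertices and add \<open>n - k\<close> further vertices, each of degree three when added;
  for the least \<open>k\<close> with \<open>k(k-1)/2 + 3(n-k) \<ge> \<epsilon> n\<^sup>2\<close> the edge density is in the required range. The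
  graph is drawn with straight edges. All but one of the clique vertices lie on the parabola
  \<open>y = x\<^sup>2\<close>; the last one, the hub, lies far below it on the \<open>y\<close>-axis, and the additional vertices
  follow below the hub on the \<open>y\<close>-axis, each joined to its predecessor and to the two extreme points
  of the parabola. Only chords of the parabola can cross. The chords between consecutive points and
  the one between the extreme points stay uncrossed, which gives \<open>2(k-1) + 3(n-k) = 3n - k - 2\<close>
  uncrossed edges, and \<open>(k-1)\<^sup>2 \<le> 2m\<close>. Three chords in a common point are avoided by choosing the
  abscissae generically.
\<close>

section \<open>Avoiding three concurrent chords\<close>

text \<open>The chord of the parabola over \<open>[a, b]\<close> lies on the line \<open>y = (a + b) x - a b\<close>; the condition
  results from eliminating \<open>x\<close> and \<open>y\<close> from three such equations.\<close>

definition chords_concurrent :: "real \<Rightarrow> real \<Rightarrow> real \<Rightarrow> real \<Rightarrow> real \<Rightarrow> real \<Rightarrow> bool" where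
  "chords_concurrent a b c d e f \<longleftrightarrow>
     (a + b - c - d) * (a * b - e * f) = (a + b - e - f) * (a * b - c * d)"

lemma chords_concurrent_swap:
  "chords_concurrent a b c d f e = chords_concurrent a b c d e f"
  "chords_concurrent a b e f c d = chords_concurrent a b c d e f"
  "chords_concurrent e f c d a b = chords_concurrent a b c d e f"
  by (auto simp: chords_concurrent_def algebra_simps)

text \<open>The condition is linear in \<open>f\<close>, so infinitely many solutions force \<alpha>
  = \<beta> = 0. But \<alpha> = 0 puts the intersection of the first two lines at abscissa
  \<open>e\<close>, and then \<beta> = 0 would make \<open>e\<close> equal to \<open>a\<close> or
  \<open>b\<close>.\<close>

lemma finite_concurrent_chords:
  assumes "a \<noteq> c" "a \<noteq> d" "e \<noteq> a" "e \<noteq> b"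
  shows "finite {f. chords_concurrent a b c d e f}"
proof -
  define \<alpha> where "\<alpha> = (a + b - c - d) * e - (a * b - c * d)"
  define \<beta> where "\<beta> = (a + b - c - d) * (a * b) - (a + b - e) * (a * b - c * d)"
  have lin: "chords_concurrent a b c d e f \<longleftrightarrow> \<beta> = f * \<alpha>" for f
    unfolding chords_concurrent_def \<alpha>_def \<beta>_def by (auto simp: algebra_simps)
  show ?thesis
  proof (cases "\<alpha> = 0")
    case True
    have pq: "a * b - c * d = (a + b - c - d) * e"
      using True by (simp add: \<alpha>_def)
    have "a + b - c - d \<noteq> 0"
    proof
      assume s: "a + b - c - d = 0"
      then have "a * b = c * d"
        using pq by auto
      then have "(a - c) * (a - d) = 0"
        using s by algebra
      then show False using assms by simp
    qed
    moreover have "\<beta> = (a + b - c - d) * ((e - a) * (e - b))"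
      unfolding \<beta>_def pq by (simp add: algebra_simps)
    ultimately have "\<beta> \<noteq> 0" using assms by simp
    then show ?thesis using True by (simp add: lin)
  next
    case False
    then have "{f. chords_concurrent a b c d e f} \<subseteq> {\<beta> / \<alpha>}"
      by (auto simp: lin field_simps)
    then show ?thesis by (rule finite_subset) simp
  qed
qed

text \<open>Crossing chords share no endpoint, hence six distinct values.\<close>

definition generic_abscissae :: "real set \<Rightarrow> bool" where
  "generic_abscissae S \<longleftrightarrow>
     (\<forall>a b c d e f. {a, b, c, d, e, f} \<subseteq> S \<longrightarrow> distinct [a, b, c, d, e, f] \<longrightarrow>
        \<not> chords_concurrent a b c d e f)"

text \<open>Each of the finitely many quintuples from \<open>S\<close> excludes finitely many
  values, and infinitely many lie above \<open>B\<close>.\<close>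

lemma generic_abscissae_extend:
  assumes "finite S" "generic_abscissae S"
  shows "\<exists>v>B. generic_abscissae (insert v S)"
proof -
  define bad where "bad = (\<Union>a\<in>S. \<Union>b\<in>S. \<Union>c\<in>S. \<Union>d\<in>S. \<Union>e\<in>S.
    {f. distinct [a, b, c, d, e] \<and> chords_concurrent a b c d e f})"
  have fin: "finite {f. distinct [a, b, c, d, e] \<and> chords_concurrent a b c d e f}" for a b c d e
  proof (cases "distinct [a, b, c, d, e]")
    case True
    then have "finite {f. chords_concurrent a b c d e f}"
      by (intro finite_concurrent_chords) auto
    then show ?thesis by (rule rev_finite_subset) blast
  next
    case False
    then have "{f. distinct [a, b, c, d, e] \<and> chords_concurrent a b c d e f} = {}" by blast
    then show ?thesis by (simp only: finite.emptyI)
  qed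
  have "finite bad"
    unfolding bad_def by (intro finite_UN_I assms(1) fin)
  moreover have "infinite {B<..}" by (rule infinite_Ioi)
  ultimately have "infinite ({B<..} - bad)" by (rule Diff_infinite_finite)
  then obtain v where v: "v > B" "v \<notin> bad"
    by (metis Diff_iff finite.emptyI greaterThan_iff ex_in_conv)
  have v_last: "\<not> chords_concurrent a b c d e v"
    if "{a, b, c, d, e} \<subseteq> S" "distinct [a, b, c, d, e]" for a b c d e
  proof
    assume conc: "chords_concurrent a b c d e v"
    have "v \<in> bad"
      unfolding bad_def
      by (rule UN_I[of a], use that in simp, rule UN_I[of b], use that in simp,
          rule UN_I[of c], use that in simp, rule UN_I[of d], use that in simp,
          rule UN_I[of e], use that in simp, rule CollectI, rule conjI[OF that(2) conc])
    then show False using v(2) by contradiction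
  qed
  have "generic_abscissae (insert v S)"
    unfolding generic_abscissae_def
  proof (intro allI impI notI)
    fix a b c d e f
    assume mem: "{a, b, c, d, e, f} \<subseteq> insert v S"
      and dist: "distinct [a, b, c, d, e, f]" and conc: "chords_concurrent a b c d e f"
    have sub: "T \<subseteq> S" if "T \<subseteq> {a, b, c, d, e, f}" "v \<notin> T" for T
      using mem that by blast
    \<comment> \<open>The symmetries of \<open>chords_concurrent\<close> move \<open>v\<close> from
      any of the six places to the last one, where \<open>v_last\<close> applies.\<close>
    consider "v \<notin> {a, b, c, d, e, f}" | "f = v" | "e = v" | "d = v" | "c = v" | "b = v" | "a = v"
      by auto
    then show False
    proof cases
      case 1
      then have "{a, b, c, d, e, f} \<subseteq> S" using sub by blast
      then show False
        using dist conc assms(2) unfolding generic_abscissae_def by blast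
    next
      case 2
      have "{a, b, c, d, e} \<subseteq> S" by (rule sub) (use 2 dist in auto)
      then show False using 2 v_last[of a b c d e] dist conc by simp
    next
      case 3
      have "{a, b, c, d, f} \<subseteq> S" by (rule sub) (use 3 dist in auto)
      moreover have "chords_concurrent a b c d f e"
        using conc chords_concurrent_swap(1) by blast
      ultimately show False using 3 v_last[of a b c d f] dist by simp
    next
      case 4
      have "{a, b, e, f, c} \<subseteq> S" by (rule sub) (use 4 dist in auto)
      moreover have "chords_concurrent a b e f c d"
        using conc chords_concurrent_swap(2) by blast
      ultimately show False using 4 v_last[of a b e f c] dist by auto
    next
      case 5
      have "{a, b, e, f, d} \<subseteq> S" by (rule sub) (use 5 dist in auto)
      moreover have "chords_concurrent a b e f d c"
        using conc chords_concurrent_swap(1,2) by blast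
      ultimately show False using 5 v_last[of a b e f d] dist by auto
    next
      case 6
      have "{e, f, c, d, a} \<subseteq> S" by (rule sub) (use 6 dist in auto)
      moreover have "chords_concurrent e f c d a b"
        using conc chords_concurrent_swap(3) by blast
      ultimately show False using 6 v_last[of e f c d a] dist by auto
    next
      case 7
      have "{e, f, c, d, b} \<subseteq> S" by (rule sub) (use 7 dist in auto)
      moreover have "chords_concurrent e f c d b a"
        using conc chords_concurrent_swap(1,3) by blast
      ultimately show False using 7 v_last[of e f c d b] dist by auto
    qed
  qed
  with v show ?thesis by blast
qed

text \<open>No point lies on the y-axis, so the abscissa tells edges on that axis from spokes; the
  opposite signs of the extreme points serve \<open>spokes_disjoint_lower_hub\<close>.\<close>

lemma ex_generic_abscissae:
  "\<exists>x :: nat \<Rightarrow> real. x 0 < 0 \<and> (\<forall>i. 0 < i \<and> i < k \<longrightarrow> 0 < x i) \<and> (\<forall>i j. i < j \<and> j < k \<longrightarrow> x i < x j) \<and>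
     generic_abscissae (x ` {..<k})"
proof (induction k)
  case 0
  show ?case by (rule exI[of _ "\<lambda>_. -1"]) (simp add: generic_abscissae_def)
next
  case (Suc k)
  then obtain x where x: "x 0 < 0" "\<And>i. 0 < i \<Longrightarrow> i < k \<Longrightarrow> 0 < x i"
    "\<And>i j. i < j \<Longrightarrow> j < k \<Longrightarrow> x i < x j" "generic_abscissae (x ` {..<k})"
    by blast
  show ?case
  proof (cases "k = 0")
    case True
    then have "x ` {..<Suc k} = {x 0}" by auto
    then have "generic_abscissae (x ` {..<Suc k})"
      by (auto simp: generic_abscissae_def)
    then show ?thesis using x(1) True by (intro exI[of _ x]) auto
  next
    case False
    \<comment> \<open>Inserting \<open>0\<close> makes the new abscissa positive as well as larger
      than all earlier ones.\<close>
    obtain v where v: "v > Max (insert 0 (x ` {..<k}))" "generic_abscissae (insert v (x ` {..<k}))"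
      using generic_abscissae_extend[OF _ x(4)] by blast
    have pos: "v > 0" and above: "x i < v" if "i < k" for i
      using v(1) that by auto
    have "(x(k := v)) ` {..<Suc k} = insert v (x ` {..<k})"
      by (auto simp: lessThan_Suc)
    then show ?thesis
      using x False pos above v by (intro exI[of _ "x(k := v)"]) (auto simp: less_Suc_eq)
  qed
qed

section \<open>Straight segments and transversal crossings\<close>

lemma open_segment_complexE:
  fixes a b z :: complex
  assumes "z \<in> open_segment a b"
  obtains u where "0 < u" "u < 1" "Re z = (1 - u) * Re a + u * Re b"
    "Im z = (1 - u) * Im a + u * Im b"
proof -
  obtain u where "0 < u" "u < 1" "z = (1 - u) *\<^sub>R a + u *\<^sub>R b"
    using assms unfolding in_segment by blast
  then show thesis by (intro that[of u]) simp_all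
qed

lemma arc_interior_linepath: "arc_interior (linepath a b) = open_segment a b"
  by (simp add: arc_interior_def open_segment_def)

text \<open>The determinant of two plane vectors, nonzero iff they are linearly independent.\<close>

definition cross2 :: "complex \<Rightarrow> complex \<Rightarrow> real" where
  "cross2 u v = Re u * Im v - Im u * Re v"

text \<open>The affine map taking \<open>z\<close> to 0 and the two directions to the coordinate
  axes is the required homeomorphism.\<close>

lemma cross_at_linepath:
  assumes z: "z \<in> open_segment a b" "z \<in> open_segment c d" and nz: "cross2 (b - a) (d - c) \<noteq> 0"
  shows "cross_at (linepath a b) (linepath c d) z"
proof -
  obtain s where s: "0 < s" "s < 1" "z = (1 - s) *\<^sub>R a + s *\<^sub>R b"
    using z(1) unfolding in_segment by auto
  obtain t where t: "0 < t" "t < 1" "z = (1 - t) *\<^sub>R c + t *\<^sub>R d"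
    using z(2) unfolding in_segment by auto
  \<comment> \<open>With this scale the points of both lines that the unit disc reaches stay inside
    the segments, so within \<open>U\<close> segments and lines coincide.\<close>
  define r where "r = min (min s (1 - s)) (min t (1 - t))"
  have r: "0 < r" "r \<le> s" "r \<le> 1 - s" "r \<le> t" "r \<le> 1 - t"
    using s t by (auto simp: r_def)
  define u where "u = r *\<^sub>R (b - a)"
  define v where "v = r *\<^sub>R (d - c)"
  define \<psi> where "\<psi> w = z + Re w *\<^sub>R u + Im w *\<^sub>R v" for w :: complex
  \<comment> \<open>The inverse of \<psi> by Cramer's rule.\<close>
  define \<phi> where "\<phi> y = Complex (cross2 (y - z) v / cross2 u v) (cross2 u (y - z) / cross2 u v)"
    for y
  define U where "U = \<phi> -` ball 0 1"
  have "cross2 u v = r * r * cross2 (b - a) (d - c)"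
    by (simp add: u_def v_def cross2_def algebra_simps)
  then have uv: "cross2 u v \<noteq> 0" using nz r by simp
  have \<phi>\<psi>: "\<phi> (\<psi> w) = w" for w
  proof (rule complex_eqI)
    have "cross2 (\<psi> w - z) v = Re w * cross2 u v" "cross2 u (\<psi> w - z) = Im w * cross2 u v"
      by (simp_all add: cross2_def \<psi>_def algebra_simps)
    then show "Re (\<phi> (\<psi> w)) = Re w" "Im (\<phi> (\<psi> w)) = Im w"
      using uv by (simp_all add: \<phi>_def)
  qed
  have \<psi>\<phi>: "\<psi> (\<phi> y) = y" for y
  proof (rule complex_eqI)
    have "cross2 (y - z) v * Re u + cross2 u (y - z) * Re v = (Re y - Re z) * cross2 u v"
      "cross2 (y - z) v * Im u + cross2 u (y - z) * Im v = (Im y - Im z) * cross2 u v"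
      by (simp_all add: cross2_def algebra_simps)
    then show "Re (\<psi> (\<phi> y)) = Re y" "Im (\<psi> (\<phi> y)) = Im y"
      using uv by (simp_all add: \<psi>_def \<phi>_def field_simps)
  qed
  have cont_\<phi>: "continuous_on S \<phi>" for S
    unfolding \<phi>_def Complex_eq cross2_def using uv
    by (intro continuous_intros) (auto simp: cross2_def)
  have cont_\<psi>: "continuous_on S \<psi>" for S
    unfolding \<psi>_def by (intro continuous_intros)
  have "open U"
    unfolding U_def by (rule open_vimage[OF open_ball cont_\<phi>])
  moreover have "\<phi> z = 0"
    by (simp add: \<phi>_def cross2_def complex_eq_iff)
  moreover have "z \<in> U" by (simp add: U_def \<open>\<phi> z = 0\<close>)
  moreover have "homeomorphism U (ball 0 1) \<phi> \<psi>"
    unfolding homeomorphism_def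
    using \<phi>\<psi> \<psi>\<phi> cont_\<phi> cont_\<psi> by (auto simp: U_def image_iff) (metis \<phi>\<psi> mem_ball_0 dist_0_norm)+
  moreover have "\<phi> ` (U \<inter> path_image (linepath a b)) = {w \<in> ball 0 1. Im w = 0}"
  proof (intro equalityI subsetI)
    fix w assume "w \<in> \<phi> ` (U \<inter> path_image (linepath a b))"
    then obtain y where y: "w = \<phi> y" "\<phi> y \<in> ball 0 1" "y \<in> closed_segment a b"
      by (auto simp: U_def)
    then obtain l where "y = (1 - l) *\<^sub>R a + l *\<^sub>R b" unfolding in_segment by auto
    then have "y - z = (l - s) *\<^sub>R (b - a)" by (simp add: s algebra_simps)
    then have "cross2 u (y - z) = 0" by (simp add: u_def cross2_def)
    then show "w \<in> {w \<in> ball 0 1. Im w = 0}" using y by (simp add: \<phi>_def)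
  next
    fix w :: complex assume w: "w \<in> {w \<in> ball 0 1. Im w = 0}"
    then have "\<bar>Re w\<bar> \<le> 1" using abs_Re_le_cmod[of w] by auto
    then have "\<bar>r * Re w\<bar> \<le> r" using r by (simp add: abs_mult mult_le_cancel_left1)
    then have l: "0 \<le> s + r * Re w" "s + r * Re w \<le> 1" using r by linarith+
    have "\<psi> w = (1 - (s + r * Re w)) *\<^sub>R a + (s + r * Re w) *\<^sub>R b"
      using w by (simp add: \<psi>_def u_def s algebra_simps)
    then have "\<psi> w \<in> closed_segment a b" using l unfolding in_segment by blast
    then show "w \<in> \<phi> ` (U \<inter> path_image (linepath a b))"
      using w \<phi>\<psi> by (auto simp: U_def image_iff intro!: bexI[of _ "\<psi> w"])
  qed
  moreover have "\<phi> ` (U \<inter> path_image (linepath c d)) = {w \<in> ball 0 1. Re w = 0}"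
  proof (intro equalityI subsetI)
    fix w assume "w \<in> \<phi> ` (U \<inter> path_image (linepath c d))"
    then obtain y where y: "w = \<phi> y" "\<phi> y \<in> ball 0 1" "y \<in> closed_segment c d"
      by (auto simp: U_def)
    then obtain l where "y = (1 - l) *\<^sub>R c + l *\<^sub>R d" unfolding in_segment by auto
    then have "y - z = (l - t) *\<^sub>R (d - c)" by (simp add: t algebra_simps)
    then have "cross2 (y - z) v = 0" by (simp add: v_def cross2_def)
    then show "w \<in> {w \<in> ball 0 1. Re w = 0}" using y by (simp add: \<phi>_def)
  next
    fix w :: complex assume w: "w \<in> {w \<in> ball 0 1. Re w = 0}"
    then have "\<bar>Im w\<bar> \<le> 1" using abs_Im_le_cmod[of w] by auto
    then have "\<bar>r * Im w\<bar> \<le> r" using r by (simp add: abs_mult mult_le_cancel_left1)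
    then have l: "0 \<le> t + r * Im w" "t + r * Im w \<le> 1" using r by linarith+
    have "\<psi> w = (1 - (t + r * Im w)) *\<^sub>R c + (t + r * Im w) *\<^sub>R d"
      using w by (simp add: \<psi>_def v_def t algebra_simps)
    then have "\<psi> w \<in> closed_segment c d" using l unfolding in_segment by blast
    then show "w \<in> \<phi> ` (U \<inter> path_image (linepath c d))"
      using w \<phi>\<psi> by (auto simp: U_def image_iff intro!: bexI[of _ "\<psi> w"])
  qed
  ultimately show ?thesis unfolding cross_at_def by blast
qed


section \<open>The layout: parabola, hub and vertices below it\<close>

text \<open>\<open>K\<close> is one less than the clique size, as the hub is off the parabola;
  \<open>2 < K\<close> keeps the chord over the extreme points distinct from those between
  neighbours.\<close>

locale parabola_layout =
  fixes x :: "nat \<Rightarrow> real" and K :: nat and M :: real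
  assumes K: "2 < K"
    and x_0: "x 0 < 0"
    and x_pos: "\<And>i. 0 < i \<Longrightarrow> i < K \<Longrightarrow> 0 < x i"
    and x_less: "\<And>i j. i < j \<Longrightarrow> j < K \<Longrightarrow> x i < x j"
    and generic: "generic_abscissae (x ` {..<K})"
    and M: "\<And>i. i < K \<Longrightarrow> (x i)\<^sup>2 < M"
begin

definition pos :: "nat \<Rightarrow> complex" where
  "pos i = (if i < K then Complex (x i) ((x i)\<^sup>2) else Complex 0 (- (M + real i)))"

text \<open>The neighbours of \<open>j\<close> among the smaller vertices; vertex \<open>K\<close> is the hub.\<close>

definition nbrs :: "nat \<Rightarrow> nat set" where
  "nbrs j = (if j \<le> K then {..<j} else {0, K - 1, j - 1})"

text \<open>An edge is an unordered pair, a path has a direction: the smaller index is the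
  start.\<close>

definition curve :: "nat set \<Rightarrow> real \<Rightarrow> complex" where
  "curve e = linepath (pos (Min e)) (pos (Max e))"

definition height :: "complex \<Rightarrow> real" where
  "height z = Im z - (Re z)\<^sup>2"

lemma M_pos: "0 < M"
  using le_less_trans[OF zero_le_power2 M[of 0]] K by simp

lemma x_nonzero: "i < K \<Longrightarrow> x i \<noteq> 0"
  using x_0 x_pos[of i] by (cases "i = 0") auto

lemma x_le: "i \<le> j \<Longrightarrow> j < K \<Longrightarrow> x i \<le> x j"
  using x_less[of i j] by (cases "i = j") auto

lemma x_inj: "i < K \<Longrightarrow> j < K \<Longrightarrow> x i = x j \<longleftrightarrow> i = j"
  using x_less[of i j] x_less[of j i] by (cases i j rule: linorder_cases) auto

text \<open>The line through \<open>pos i\<close> and \<open>pos j\<close> meets the y-axis at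
  \<open>- (x i * x j)\<close>, so the hub and all vertices below it lie under every such
  line.\<close>

lemma x_mult_less_M:
  assumes "i < K" "j < K"
  shows "x i * x j < M"
proof -
  have "2 * (x i * x j) \<le> (x i)\<^sup>2 + (x j)\<^sup>2"
    using zero_le_power2[of "x i - x j"] by (simp add: power2_diff)
  then show ?thesis using M[OF assms(1)] M[OF assms(2)] by linarith
qed

lemma nbrs_less: "i \<in> nbrs j \<Longrightarrow> i < j"
  using K by (auto simp: nbrs_def split: if_splits)

lemma pos_inj: "pos i = pos j \<longleftrightarrow> i = j"
  using x_inj x_nonzero by (auto simp: pos_def)

lemma curve_pair: "i < j \<Longrightarrow> curve {i, j} = linepath (pos i) (pos j)"
  by (simp add: curve_def)

lemma height_pos: "i < K \<Longrightarrow> height (pos i) = 0" "K \<le> i \<Longrightarrow> height (pos i) < 0"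
  using M_pos by (auto simp: height_def pos_def)

text \<open>\<open>height\<close> separates the chords (positive in the interior) from all other edges (negative).\<close>

lemma chord_point:
  assumes "z \<in> open_segment (pos i) (pos j)" "i < j" "j < K"
  shows "x i < Re z" "Re z < x j" "Im z = (x i + x j) * Re z - x i * x j"
    "height z = (Re z - x i) * (x j - Re z)" "0 < height z"
proof -
  obtain u where u: "0 < u" "u < 1" and re: "Re z = (1 - u) * x i + u * x j"
    and im: "Im z = (1 - u) * (x i)\<^sup>2 + u * (x j)\<^sup>2"
    using open_segment_complexE[OF assms(1)] assms(2,3) by (auto simp: pos_def)
  have lt: "x i < x j" using x_less assms by blast
  have "Re z - x i = u * (x j - x i)" "x j - Re z = (1 - u) * (x j - x i)"
    by (simp_all add: re algebra_simps)
  then show l: "x i < Re z" "Re z < x j"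
    using u lt by (smt (verit) mult_pos_pos)+
  show y: "Im z = (x i + x j) * Re z - x i * x j"
    unfolding re im by (simp add: power2_eq_square algebra_simps)
  show h: "height z = (Re z - x i) * (x j - Re z)"
    unfolding height_def y by (simp add: power2_eq_square algebra_simps)
  show "0 < height z" unfolding h using l by simp
qed

text \<open>At parameter \<open>u\<close> the height is
  \<open>- u * ((M + real j) - (1 - u) * (x i)\<^sup>2)\<close>, negative since \<open>M\<close>
  exceeds \<open>(x i)\<^sup>2\<close>.\<close>

lemma spoke_point:
  assumes "z \<in> open_segment (pos i) (pos j)" "i < K" "K \<le> j"
  obtains u where "0 < u" "u < 1" "Re z = (1 - u) * x i"
    "Im z = (1 - u) * (x i)\<^sup>2 - u * (M + real j)" "height z < 0" "Re z \<noteq> 0"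
proof -
  obtain u where u: "0 < u" "u < 1" and re0: "Re z = (1 - u) * Re (pos i) + u * Re (pos j)"
    and im0: "Im z = (1 - u) * Im (pos i) + u * Im (pos j)"
    using open_segment_complexE[OF assms(1)] by blast
  have re: "Re z = (1 - u) * x i" and im: "Im z = (1 - u) * (x i)\<^sup>2 - u * (M + real j)"
    using re0 im0 assms(2,3) by (simp_all add: pos_def algebra_simps)
  have "height z = - u * ((M + real j) - (1 - u) * (x i)\<^sup>2)"
    unfolding height_def re im by (simp add: power2_eq_square algebra_simps)
  moreover have "(1 - u) * (x i)\<^sup>2 \<le> (x i)\<^sup>2"
    using u by (simp add: mult_left_le_one_le)
  then have "(M + real j) - (1 - u) * (x i)\<^sup>2 > 0"
    using M[OF assms(2)] by linarith
  ultimately have "height z < 0"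
    using u by (simp add: mult_less_0_iff)
  moreover have "Re z \<noteq> 0" using re u x_nonzero[OF assms(2)] by simp
  ultimately show thesis using that u re im by blast
qed

lemma spoke_height:
  assumes "z \<in> open_segment (pos i) (pos j)" "i < K" "K \<le> j"
  shows "height z < 0" "Re z \<noteq> 0"
  using spoke_point[OF assms] by blast+

lemma axis_point:
  assumes "z \<in> open_segment (pos i) (pos j)" "K \<le> i" "i < j"
  shows "Re z = 0" "Im z < - (M + real i)" "- (M + real j) < Im z" "height z < 0"
proof -
  obtain u where u: "0 < u" "u < 1" and re0: "Re z = (1 - u) * Re (pos i) + u * Re (pos j)"
    and im0: "Im z = (1 - u) * Im (pos i) + u * Im (pos j)"
    using open_segment_complexE[OF assms(1)] by blast
  have re: "Re z = 0" and im: "Im z = - (1 - u) * (M + real i) - u * (M + real j)"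
    using re0 im0 assms(2,3) by (simp_all add: pos_def algebra_simps)
  have "Im z = - (M + real i) - u * (real j - real i)"
    "Im z = - (M + real j) + (1 - u) * (real j - real i)"
    unfolding im by (simp_all add: algebra_simps)
  moreover have "0 < u * (real j - real i)" "0 < (1 - u) * (real j - real i)"
    using u assms by simp_all
  ultimately show *: "Im z < - (M + real i)" "- (M + real j) < Im z" by linarith+
  show "Re z = 0" by (rule re)
  then show "height z < 0" using * M_pos by (simp add: height_def)
qed

section \<open>Edges ending at the hub or below cross nothing\<close>

text \<open>Two different spokes meeting would make \<open>pos i\<close>, \<open>pos i'\<close> and
  \<open>pos j\<close> collinear, but the line through the first two meets the y-axis above
  \<open>pos j\<close>.\<close>

lemma spokes_disjoint_same_hub:
  assumes "z \<in> open_segment (pos i) (pos j)" "z \<in> open_segment (pos i') (pos j)"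
    "i < K" "i' < K" "K \<le> j"
  shows "i = i'"
proof -
  obtain u where u: "0 < u" "u < 1" "Re z = (1 - u) * x i"
    "Im z = (1 - u) * (x i)\<^sup>2 - u * (M + real j)" using assms by (auto elim: spoke_point)
  obtain v where v: "0 < v" "v < 1" "Re z = (1 - v) * x i'"
    "Im z = (1 - v) * (x i')\<^sup>2 - v * (M + real j)" using assms by (auto elim: spoke_point)
  define N where "N = M + real j"
  have eqs: "(1 - u) * x i = (1 - v) * x i'" "(1 - u) * ((x i)\<^sup>2 + N) = (1 - v) * ((x i')\<^sup>2 + N)"
    using u v by (simp_all add: N_def algebra_simps)
  have "(1 - u) * (1 - v) * ((x i - x i') * (x i * x i' - N)) = 0"
    using eqs by algebra
  moreover have "x i * x i' - N \<noteq> 0"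
    using x_mult_less_M[OF assms(3,4)] by (simp add: N_def)
  ultimately show ?thesis using u v x_inj assms by simp
qed

text \<open>The line through \<open>pos i'\<close> and \<open>pos j'\<close> has \<open>pos j\<close> strictly on one side, and
  \<open>pos i\<close> on the same side or on the line.\<close>

lemma spokes_disjoint_lower_hub:
  assumes z: "z \<in> open_segment (pos i) (pos j)" "z \<in> open_segment (pos i') (pos j')"
    and ij: "i < K" "K \<le> j" "j < j'" "i' = 0 \<or> i' = K - 1"
  shows False
proof -
  have i': "i' < K" "K \<le> j'" using ij K by auto
  obtain u where u: "0 < u" "u < 1" "Re z = (1 - u) * x i"
    "Im z = (1 - u) * (x i)\<^sup>2 - u * (M + real j)" using z(1) ij by (auto elim: spoke_point)
  obtain v where v: "0 < v" "v < 1" "Re z = (1 - v) * x i'"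
    "Im z = (1 - v) * (x i')\<^sup>2 - v * (M + real j')" using z(2) i' by (auto elim: spoke_point)
  define N where "N = M + real j'"
  \<comment> \<open>The equation of the line through \<open>pos i'\<close> and
    \<open>pos j'\<close>; the extra factor \<open>x i'\<close> makes the sign the same for both
    extreme points.\<close>
  have "x i' * ((Im z + N) * x i' - Re z * ((x i')\<^sup>2 + N)) = 0"
    unfolding v N_def by (simp add: power2_eq_square algebra_simps)
  \<comment> \<open>The values at \<open>pos j\<close> and \<open>pos i\<close>, weighted by
    \<open>u\<close> and \<open>1 - u\<close>.\<close>
  moreover have "x i' * ((Im z + N) * x i' - Re z * ((x i')\<^sup>2 + N)) =
      u * ((real j' - real j) * (x i')\<^sup>2) + (1 - u) * ((x i' * (x i - x i')) * (x i * x i' - N))"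
    unfolding u N_def by (simp add: power2_eq_square algebra_simps)
  moreover have "0 < u * ((real j' - real j) * (x i')\<^sup>2)"
    using u ij x_nonzero[OF i'(1)] by simp
  moreover have "0 \<le> (1 - u) * ((x i' * (x i - x i')) * (x i * x i' - N))"
  proof -
    \<comment> \<open>Here \<open>i'\<close> must be extreme: \<open>x i'\<close> is negative and
      least, or positive and greatest.\<close>
    have "x i' * (x i - x i') \<le> 0"
      using ij(4)
    proof
      assume "i' = 0"
      then show ?thesis using x_0 x_le[of 0 i] ij by (simp add: mult_le_0_iff)
    next
      assume "i' = K - 1"
      then show ?thesis using x_pos[of "K - 1"] x_le[of i "K - 1"] ij K
        by (simp add: mult_le_0_iff)
    qed
    moreover have "x i * x i' - N \<le> 0"
      using x_mult_less_M[OF ij(1) i'(1)] by (simp add: N_def)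
    ultimately show ?thesis using u by (simp add: mult_nonpos_nonpos)
  qed
  ultimately show False by linarith
qed

text \<open>Negative height excludes chords, and a zero abscissa separates edges on the y-axis from
  spokes. The former occupy disjoint intervals, the latter are covered by the two preceding
  lemmas.\<close>

lemma segments_disjoint:
  assumes e: "i \<in> nbrs j" "i' \<in> nbrs j'" "(i, j) \<noteq> (i', j')" and "K \<le> j \<or> K \<le> j'"
  shows "open_segment (pos i) (pos j) \<inter> open_segment (pos i') (pos j') = {}"
proof -
  have False
    if z: "z \<in> open_segment (pos i) (pos j)" "z \<in> open_segment (pos i') (pos j')"
      and e: "i \<in> nbrs j" "i' \<in> nbrs j'" "(i, j) \<noteq> (i', j')" and "K \<le> j'" "j \<le> j'"
    for z i j i' j'
  proof -
    have lt: "i < j" "i' < j'" using e nbrs_less by auto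
    have neg: "height z < 0"
      using spoke_height(1)[OF z(2)] axis_point(4)[OF z(2)] \<open>K \<le> j'\<close> lt by fastforce
    have Kj: "K \<le> j"
      using chord_point(5)[OF z(1) lt(1)] neg by fastforce
    have succ: "i = j - 1" if "K \<le> i"
      using that e(1) lt(1) K by (auto simp: nbrs_def split: if_splits)
    have succ': "i' = j' - 1" if "K \<le> i'"
      using that e(2) lt(2) K by (auto simp: nbrs_def split: if_splits)
    have axis: "Re z = 0 \<longleftrightarrow> K \<le> i"
      using spoke_height(2)[OF z(1)] axis_point(1)[OF z(1)] Kj lt by fastforce
    have axis': "Re z = 0 \<longleftrightarrow> K \<le> i'"
      using spoke_height(2)[OF z(2)] axis_point(1)[OF z(2)] \<open>K \<le> j'\<close> lt by fastforce
    show False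
    proof (cases "K \<le> i")
      case True
      then have Ki': "K \<le> i'" using axis axis' by simp
      then have "j \<noteq> j'" using e(3) succ succ' True by auto
      then have "j \<le> i'" using succ'[OF Ki'] \<open>j \<le> j'\<close> by simp
      then have "real j \<le> real i'" by simp
      then show False
        using axis_point(3)[OF z(1) True lt(1)] axis_point(2)[OF z(2) Ki' lt(2)] by linarith
    next
      case False
      then have sp: "i < K" "i' < K" using axis axis' by auto
      show False
      proof (cases "j = j'")
        case True
        then show False using spokes_disjoint_same_hub z sp Kj e(3) by blast
      next
        case False
        then have "j < j'" using \<open>j \<le> j'\<close> by simp
        \<comment> \<open>\<open>j' > K\<close> lies below the hub, so besides its predecessor its
          smaller neighbours are only the extreme points.\<close>
        moreover have "i' = 0 \<or> i' = K - 1"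
          using e(2) \<open>j < j'\<close> Kj sp(2) by (auto simp: nbrs_def split: if_splits)
        ultimately show False using spokes_disjoint_lower_hub[OF z sp(1) Kj] by blast
      qed
    qed
  qed
  note key = this
  show ?thesis
  proof (rule ccontr)
    assume "\<not> ?thesis"
    then obtain z where z: "z \<in> open_segment (pos i) (pos j)" "z \<in> open_segment (pos i') (pos j')"
      by blast
    show False
      using key[OF z e] key[OF z(2,1) e(2,1)] e(3) assms(4) by (metis le_trans linear)
  qed
qed

text \<open>Parabola points have height 0, unlike interior points of edges; the remaining vertices
  lie on the y-axis, where edges join consecutive vertices only.\<close>

lemma segment_avoids_vertices:
  assumes e: "i \<in> nbrs j"
  shows "pos l \<notin> open_segment (pos i) (pos j)"
proof
  assume z: "pos l \<in> open_segment (pos i) (pos j)"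
  have lt: "i < j" using e nbrs_less by auto
  have h: "height (pos l) \<le> 0" using height_pos[of l] by force
  have Kj: "K \<le> j" using chord_point(5)[OF z lt] h by fastforce
  have neg: "height (pos l) < 0"
    using spoke_height(1)[OF z] axis_point(4)[OF z] Kj lt by fastforce
  then have Kl: "K \<le> l" using height_pos(1)[of l] by (cases "l < K") auto
  then have re: "Re (pos l) = 0" and im: "Im (pos l) = - (M + real l)" by (auto simp: pos_def)
  have Ki: "K \<le> i" using spoke_height(2)[OF z] re Kj by fastforce
  then have "i = j - 1"
    using e lt Ki K by (auto simp: nbrs_def split: if_splits)
  then show False
    using axis_point(2,3)[OF z Ki lt] im by simp
qed

section \<open>Crossings among the chords\<close>

text \<open>At a common point both chords have the same \<open>height\<close>, a product that grows
  strictly when the interval widens. So neither interval contains the other, and the endpoints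
  interleave.\<close>

lemma crossing_chords:
  assumes z: "z \<in> open_segment (pos i) (pos j)" "z \<in> open_segment (pos i') (pos j')"
    and lt: "i < j" "i' < j'" and K: "j < K" "j' < K" and ne: "(i, j) \<noteq> (i', j')"
  shows "distinct [i, j, i', j']"
    "(x i + x j - x i' - x j') * Re z = x i * x j - x i' * x j'" "x i + x j \<noteq> x i' + x j'"
    "i < i' \<and> i' < j \<and> j < j' \<or> i' < i \<and> i < j' \<and> j' < j"
proof -
  note c = chord_point[OF z(1) lt(1) K(1)] and c' = chord_point[OF z(2) lt(2) K(2)]
  show eq: "(x i + x j - x i' - x j') * Re z = x i * x j - x i' * x j'"
    using c(3) c'(3) by (simp add: algebra_simps)
  have prod: "(Re z - x i) * (x j - Re z) = (Re z - x i') * (x j' - Re z)"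
    using c(4) c'(4) by simp
  have nested: "i = i' \<and> j = j'" if "i' \<le> i" "j \<le> j'" "i < j" "j' < K"
    and c: "x i < Re z" "Re z < x j" "(Re z - x i) * (x j - Re z) = (Re z - x i') * (x j' - Re z)"
    for i j i' j'
  proof -
    have le: "x i' \<le> x i" "x j \<le> x j'" using x_le that by auto
    have "Re z - x i < Re z - x i' \<or> x j - Re z < x j' - Re z" if "\<not> (i = i' \<and> j = j')"
      using that \<open>i' \<le> i\<close> \<open>j \<le> j'\<close> \<open>i < j\<close> \<open>j' < K\<close> x_less[of i' i] x_less[of j j'] by auto
    then show ?thesis
      using mult_less_le_imp_less[of "Re z - x i" "Re z - x i'" "x j - Re z" "x j' - Re z"]
        mult_le_less_imp_less[of "Re z - x i" "Re z - x i'" "x j - Re z" "x j' - Re z"] le c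
      by fastforce
  qed
  have n1: "\<not> (i' \<le> i \<and> j \<le> j')"
    using nested[of i' i j j'] c(1,2) prod lt K ne by auto
  have n2: "\<not> (i \<le> i' \<and> j' \<le> j)"
    using nested[of i i' j' j] c'(1,2) prod lt K ne by auto
  have "i' < j" using c(2) c'(1) x_le[of j i'] lt K by fastforce
  moreover have "i < j'" using c(1) c'(2) x_le[of j' i] lt K by fastforce
  ultimately show inter: "i < i' \<and> i' < j \<and> j < j' \<or> i' < i \<and> i < j' \<and> j' < j"
    using n1 n2 by linarith
  then show "distinct [i, j, i', j']" using lt by auto
  show "x i + x j \<noteq> x i' + x j'"
  proof
    assume s: "x i + x j = x i' + x j'"
    \<comment> \<open>Equal sums and products would identify the endpoint \<open>x i\<close> with
      \<open>x i'\<close> or \<open>x j'\<close>.\<close>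
    then have "x i * x j = x i' * x j'" using eq by simp
    then have "(x i - x i') * (x i - x j') = 0" using s by algebra
    then have "x i = x i' \<or> x i = x j'" by simp
    then show False using inter x_inj lt K by (metis less_irrefl less_trans)
  qed
qed

lemma finite_segment_inter:
  assumes e: "i \<in> nbrs j" "i' \<in> nbrs j'" "(i, j) \<noteq> (i', j')"
  shows "finite (open_segment (pos i) (pos j) \<inter> open_segment (pos i') (pos j'))"
    (is "finite ?I")
proof (cases "K \<le> j \<or> K \<le> j'")
  case True
  then show ?thesis using segments_disjoint[OF e] by simp
next
  case False
  then have lt: "i < j" "i' < j'" "j < K" "j' < K" using e nbrs_less by auto
  have "z = w" if "z \<in> ?I" "w \<in> ?I" for z w
  proof -
    have z: "z \<in> open_segment (pos i) (pos j)" "z \<in> open_segment (pos i') (pos j')"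
      and w: "w \<in> open_segment (pos i) (pos j)" "w \<in> open_segment (pos i') (pos j')"
      using that by auto
    \<comment> \<open>The slopes differ, so the linear equation for the abscissa has one
      solution.\<close>
    have "Re z = Re w"
      using crossing_chords(2,3)[OF z lt e(3)] crossing_chords(2)[OF w lt e(3)]
      by (metis diff_diff_add mult_left_cancel right_minus_eq)
    then show ?thesis
      using chord_point(3)[OF z(1) lt(1,3)] chord_point(3)[OF w(1) lt(1,3)]
      by (simp add: complex_eq_iff)
  qed
  then have "?I = {} \<or> (\<exists>z. ?I = {z})" by blast
  then show ?thesis by (metis finite.emptyI finite_insert)
qed

lemma crossing_segments_cross_at:
  assumes e: "i \<in> nbrs j" "i' \<in> nbrs j'" "(i, j) \<noteq> (i', j')"
    and z: "z \<in> open_segment (pos i) (pos j)" "z \<in> open_segment (pos i') (pos j')"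
  shows "cross_at (linepath (pos i) (pos j)) (linepath (pos i') (pos j')) z"
proof (rule cross_at_linepath[OF z])
  have "j < K" "j' < K" using segments_disjoint[OF e] z by (meson disjoint_iff not_le)+
  then have lt: "i < j" "i' < j'" "j < K" "j' < K" using e nbrs_less by auto
  \<comment> \<open>Two widths times the difference of the slopes.\<close>
  have "cross2 (pos j - pos i) (pos j' - pos i') =
      (x j - x i) * (x j' - x i') * ((x i' + x j') - (x i + x j))"
    using lt by (simp add: pos_def cross2_def power2_eq_square algebra_simps)
  then show "cross2 (pos j - pos i) (pos j' - pos i') \<noteq> 0"
    using crossing_chords(3)[OF z lt e(3)] x_less[OF lt(1,3)] x_less[OF lt(2,4)] by simp
qed

text \<open>Edges meeting in pairs are chords, their six endpoints are distinct, and genericity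
  applies.\<close>

lemma no_three_segments_concurrent:
  assumes e: "i\<^sub>1 \<in> nbrs j\<^sub>1" "i\<^sub>2 \<in> nbrs j\<^sub>2" "i\<^sub>3 \<in> nbrs j\<^sub>3"
    and ne: "(i\<^sub>1, j\<^sub>1) \<noteq> (i\<^sub>2, j\<^sub>2)" "(i\<^sub>1, j\<^sub>1) \<noteq> (i\<^sub>3, j\<^sub>3)" "(i\<^sub>2, j\<^sub>2) \<noteq> (i\<^sub>3, j\<^sub>3)"
    and z: "z \<in> open_segment (pos i\<^sub>1) (pos j\<^sub>1)" "z \<in> open_segment (pos i\<^sub>2) (pos j\<^sub>2)"
      "z \<in> open_segment (pos i\<^sub>3) (pos j\<^sub>3)"
  shows False
proof -
  have jK: "j\<^sub>1 < K" "j\<^sub>2 < K" "j\<^sub>3 < K"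
    using segments_disjoint[OF e(1,2) ne(1)] segments_disjoint[OF e(1,3) ne(2)] z
    by (meson disjoint_iff not_le)+
  have lt: "i\<^sub>1 < j\<^sub>1" "i\<^sub>2 < j\<^sub>2" "i\<^sub>3 < j\<^sub>3" using e nbrs_less by auto
  note c12 = crossing_chords[OF z(1,2) lt(1,2) jK(1,2) ne(1)]
    and c13 = crossing_chords[OF z(1,3) lt(1,3) jK(1,3) ne(2)]
    and c23 = crossing_chords[OF z(2,3) lt(2,3) jK(2,3) ne(3)]
  have iK: "i\<^sub>1 < K" "i\<^sub>2 < K" "i\<^sub>3 < K" using lt jK by auto
  have "distinct [i\<^sub>1, j\<^sub>1, i\<^sub>2, j\<^sub>2, i\<^sub>3, j\<^sub>3]"
    using c12(1) c13(1) c23(1) by simp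
  then have "distinct [x i\<^sub>1, x j\<^sub>1, x i\<^sub>2, x j\<^sub>2, x i\<^sub>3, x j\<^sub>3]"
    using iK jK by (simp add: x_inj)
  \<comment> \<open>Both sides become the product of two slope differences and
    \<open>Re z\<close>.\<close>
  moreover have "chords_concurrent (x i\<^sub>1) (x j\<^sub>1) (x i\<^sub>2) (x j\<^sub>2) (x i\<^sub>3) (x j\<^sub>3)"
    unfolding chords_concurrent_def c12(2)[symmetric] c13(2)[symmetric] by simp
  moreover have "{x i\<^sub>1, x j\<^sub>1, x i\<^sub>2, x j\<^sub>2, x i\<^sub>3, x j\<^sub>3} \<subseteq> x ` {..<K}"
    using iK jK by simp
  ultimately show False
    using generic unfolding generic_abscissae_def by blast
qed

section \<open>The graph and its drawing\<close>

text \<open>Each edge is listed once, at its larger endpoint, so that counting edges means summing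
  \<open>card (nbrs j)\<close>.\<close>

definition edges :: "nat \<Rightarrow> nat set set" where
  "edges n = (\<lambda>(j, i). {i, j}) ` (SIGMA j:{..<n}. nbrs j)"

lemma edgesE:
  assumes "e \<in> edges n"
  obtains i j where "e = {i, j}" "i \<in> nbrs j" "i < j" "j < n"
  using assms nbrs_less unfolding edges_def by auto

lemma drawing_edges: "drawing {..<n} (edges n) pos curve"
  unfolding drawing_def
proof (intro conjI ballI impI)
  show "inj_on pos {..<n}" using pos_inj by (simp add: inj_on_def)
next
  fix e assume "e \<in> edges n"
  then obtain i j where e: "e = {i, j}" "i \<in> nbrs j" "i < j" by (rule edgesE)
  show "arc (curve e)" using e pos_inj by (simp add: curve_pair arc_linepath)
  show "{pathstart (curve e), pathfinish (curve e)} = pos ` e" using e by (simp add: curve_pair)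
  show "path_image (curve e) \<inter> pos ` {..<n} \<subseteq> pos ` e"
    using e segment_avoids_vertices[OF e(2)]
    by (auto simp: curve_pair closed_segment_eq_open)
next
  fix e f assume "e \<in> edges n" "f \<in> edges n" and ne: "e \<noteq> f"
  obtain i j where e: "e = {i, j}" "i \<in> nbrs j" "i < j"
    using \<open>e \<in> edges n\<close> by (rule edgesE)
  obtain i' j' where f: "f = {i', j'}" "i' \<in> nbrs j'" "i' < j'"
    using \<open>f \<in> edges n\<close> by (rule edgesE)
  have ne': "(i, j) \<noteq> (i', j')" using ne e f by auto
  have "path_image (curve e) \<inter> path_image (curve f) \<subseteq> {pos i, pos j, pos i', pos j'} \<union>
      (open_segment (pos i) (pos j) \<inter> open_segment (pos i') (pos j'))"
    using e f by (auto simp: curve_pair closed_segment_eq_open)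
  then show "finite (path_image (curve e) \<inter> path_image (curve f))"
    by (rule finite_subset) (simp add: finite_segment_inter[OF e(2) f(2) ne'])
  show "\<nexists>z. touch_at (curve e) (curve f) z"
    using crossing_segments_cross_at[OF e(2) f(2) ne'] e f
    by (auto simp: touch_at_def curve_pair arc_interior_linepath)
next
  fix e f g assume "e \<in> edges n" "f \<in> edges n" "g \<in> edges n" and ne: "e \<noteq> f \<and> e \<noteq> g \<and> f \<noteq> g"
  obtain i\<^sub>1 j\<^sub>1 where e: "e = {i\<^sub>1, j\<^sub>1}" "i\<^sub>1 \<in> nbrs j\<^sub>1" "i\<^sub>1 < j\<^sub>1"
    using \<open>e \<in> edges n\<close> by (rule edgesE)
  obtain i\<^sub>2 j\<^sub>2 where f: "f = {i\<^sub>2, j\<^sub>2}" "i\<^sub>2 \<in> nbrs j\<^sub>2" "i\<^sub>2 < j\<^sub>2"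
    using \<open>f \<in> edges n\<close> by (rule edgesE)
  obtain i\<^sub>3 j\<^sub>3 where g: "g = {i\<^sub>3, j\<^sub>3}" "i\<^sub>3 \<in> nbrs j\<^sub>3" "i\<^sub>3 < j\<^sub>3"
    using \<open>g \<in> edges n\<close> by (rule edgesE)
  have "(i\<^sub>1, j\<^sub>1) \<noteq> (i\<^sub>2, j\<^sub>2)" "(i\<^sub>1, j\<^sub>1) \<noteq> (i\<^sub>3, j\<^sub>3)" "(i\<^sub>2, j\<^sub>2) \<noteq> (i\<^sub>3, j\<^sub>3)"
    using ne e f g by auto
  note no3 = no_three_segments_concurrent[OF e(2) f(2) g(2) this]
  show "arc_interior (curve e) \<inter> arc_interior (curve f) \<inter> arc_interior (curve g) = {}"
    using e f g no3 by (auto simp: curve_pair arc_interior_linepath)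
qed

section \<open>The edges that stay uncrossed\<close>

text \<open>Among the chords these are the sides of the convex polygon spanned by the parabola
  points.\<close>

definition free_nbrs :: "nat \<Rightarrow> nat set" where
  "free_nbrs j = (if K \<le> j then nbrs j else if j = 0 then {}
     else if j = K - 1 then {0, j - 1} else {j - 1})"

definition free_edges :: "nat \<Rightarrow> nat set set" where
  "free_edges n = (\<lambda>(j, i). {i, j}) ` (SIGMA j:{..<n}. free_nbrs j)"

lemma free_nbrs_subset: "free_nbrs j \<subseteq> nbrs j"
proof (cases "K \<le> j")
  case True
  then show ?thesis by (simp add: free_nbrs_def)
next
  case False
  then show ?thesis by (auto simp: free_nbrs_def nbrs_def)
qed

text \<open>No chord interleaves with a side of the polygon: no index lies strictly between
  neighbours, and none outside the range from \<open>0\<close> to \<open>K - 1\<close>.\<close>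

lemma free_segment_disjoint:
  assumes e: "i \<in> free_nbrs j" "i' \<in> nbrs j'" "(i, j) \<noteq> (i', j')"
  shows "open_segment (pos i) (pos j) \<inter> open_segment (pos i') (pos j') = {}"
proof (cases "K \<le> j \<or> K \<le> j'")
  case True
  then show ?thesis using segments_disjoint e free_nbrs_subset by blast
next
  case False
  have i: "i \<in> nbrs j" using e free_nbrs_subset by blast
  have lt: "i < j" "i' < j'" "j < K" "j' < K" using False i e nbrs_less by auto
  have "i = j - 1 \<or> i = 0 \<and> j = K - 1"
    using e(1) lt by (auto simp: free_nbrs_def split: if_splits)
  then have "\<not> (i < i' \<and> i' < j \<and> j < j' \<or> i' < i \<and> i < j' \<and> j' < j)"
    using lt by auto
  then show ?thesis
    using crossing_chords(4)[OF _ _ lt e(3)] by blast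
qed

lemma free_edges_uncrossed: "free_edges n \<subseteq> uncrossed_edges (edges n) curve"
proof
  fix e assume "e \<in> free_edges n"
  then obtain i j where e: "e = {i, j}" "i \<in> free_nbrs j" "j < n"
    unfolding free_edges_def by auto
  have i: "i \<in> nbrs j" "i < j" using e free_nbrs_subset nbrs_less by auto
  have "arc_interior (curve e) \<inter> arc_interior (curve f) = {}" if "f \<in> edges n" "f \<noteq> e" for f
  proof -
    obtain i' j' where f: "f = {i', j'}" "i' \<in> nbrs j'" "i' < j'"
      using \<open>f \<in> edges n\<close> by (rule edgesE)
    have "(i, j) \<noteq> (i', j')" using that e f by auto
    then show ?thesis
      using free_segment_disjoint[OF e(2) f(2)] i e f
      by (simp add: curve_pair arc_interior_linepath)
  qed
  moreover have "e \<in> edges n" using e i by (force simp: edges_def)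
  ultimately show "e \<in> uncrossed_edges (edges n) curve" by (simp add: uncrossed_edges_def)
qed

section \<open>Counting edges; simplicity and connectedness\<close>

lemma inj_on_pairs: "inj_on (\<lambda>(j, i). {i, j}) (SIGMA j:{..<n}. nbrs j)"
proof (rule inj_onI)
  fix p q assume "p \<in> (SIGMA j:{..<n}. nbrs j)" "q \<in> (SIGMA j:{..<n}. nbrs j)"
    and eq: "(\<lambda>(j, i). {i, j}) p = (\<lambda>(j, i). {i, j}) q"
  then have "snd p < fst p" "snd q < fst q" using nbrs_less by auto
  then show "p = q" using eq by (auto simp: doubleton_eq_iff split: prod.splits)
qed

lemma finite_nbrs: "finite (nbrs j)"
  by (simp add: nbrs_def)

lemma card_edges: "card (edges n) = (\<Sum>j<n. card (nbrs j))"
  unfolding edges_def by (simp add: card_image[OF inj_on_pairs] finite_nbrs)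

lemma card_free_edges: "card (free_edges n) = (\<Sum>j<n. card (free_nbrs j))"
proof -
  have "inj_on (\<lambda>(j, i). {i, j}) (SIGMA j:{..<n}. free_nbrs j)"
    by (rule inj_on_subset[OF inj_on_pairs]) (use free_nbrs_subset in blast)
  moreover have "finite (free_nbrs j)" for j
    using finite_subset[OF free_nbrs_subset finite_nbrs] .
  ultimately show ?thesis
    unfolding free_edges_def by (simp add: card_image)
qed

lemma card_nbrs: "card (nbrs j) = (if j \<le> K then j else 3)"
  using K by (auto simp: nbrs_def card_insert_if)

text \<open>Vertex \<open>j \<le> K\<close> contributes \<open>j\<close> edges and each of the
  \<open>r\<close> later ones three; doubling avoids the division in the triangular number.\<close>

lemma card_edges_eq: "2 * card (edges (Suc K + r)) = Suc K * K + 6 * r"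
proof (induction r)
  case 0
  have tri: "2 * (\<Sum>j<m. card (nbrs j)) = m * (m - 1)" if "m \<le> Suc K" for m
    using that
  proof (induction m)
    case (Suc m)
    then show ?case by (cases m) (auto simp: card_nbrs algebra_simps)
  qed simp
  show ?case using tri[of "Suc K"] by (simp add: card_edges del: sum.lessThan_Suc)
next
  case (Suc r)
  then show ?case by (simp add: card_edges card_nbrs)
qed

text \<open>The polygon has \<open>K\<close> sides and the hub \<open>K\<close> spokes; each later
  vertex adds three edges.\<close>

lemma card_free_edges_eq: "card (free_edges (Suc K + r)) = 2 * K + 3 * r"
proof (induction r)
  case 0
  \<comment> \<open>The indices \<open>K - 1\<close> and \<open>K\<close> are split off: the first
    \<open>Suc L\<close> vertices contribute \<open>L\<close> sides, the other two contribute 2 and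
    \<open>K\<close>.\<close>
  define L where "L = K - 2"
  have L: "Suc L = K - 1" "Suc (Suc L) = K" using K by (auto simp: L_def)
  have path: "card (free_nbrs j) = (if j = 0 then 0 else 1)" if "j < K - 1" for j
    using that by (auto simp: free_nbrs_def)
  have "(\<Sum>j<m. card (free_nbrs j)) = m - 1" if "m \<le> K - 1" for m
    using that
  proof (induction m)
    case (Suc m)
    then show ?case by (simp add: path)
  qed simp
  then have "(\<Sum>j<Suc L. card (free_nbrs j)) = L" using L(1) by (metis diff_Suc_1 order_refl)
  moreover have "card (free_nbrs (K - 1)) = 2" "card (free_nbrs K) = K"
    using K by (auto simp: free_nbrs_def card_nbrs)
  then have "card (free_nbrs (Suc L)) = 2" "card (free_nbrs (Suc (Suc L))) = K"
    using L by metis+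
  ultimately have "(\<Sum>j<Suc (Suc (Suc L)). card (free_nbrs j)) = L + 2 + K" by simp
  then show ?case unfolding card_free_edges L(2) using L(2) by simp
next
  case (Suc r)
  then show ?case by (simp add: card_free_edges free_nbrs_def card_nbrs)
qed

lemma simple_graph_edges: "simple_graph {..<n} (edges n)"
proof -
  have "e \<subseteq> {..<n} \<and> card e = 2" if "e \<in> edges n" for e
    using that by (rule edgesE) auto
  then show ?thesis by (simp add: simple_graph_def)
qed

text \<open>Vertex \<open>0\<close> is adjacent to all others.\<close>

lemma connected_graph_edges:
  assumes "0 < n"
  shows "connected_graph {..<n} (edges n)"
proof -
  let ?R = "{(u, v). {u, v} \<in> edges n}"
  have star: "{0, v} \<in> edges n" if "0 < v" "v < n" for v
  proof -
    have "0 \<in> nbrs v" using that by (simp add: nbrs_def)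
    then show ?thesis using that by (force simp: edges_def)
  qed
  have to0: "(v, 0) \<in> ?R\<^sup>*" and from0: "(0, v) \<in> ?R\<^sup>*" if "v < n" for v
    using star[of v] that by (cases "v = 0"; force simp: insert_commute)+
  have "(u, v) \<in> ?R\<^sup>*" if "u < n" "v < n" for u v
    using to0[OF that(1)] from0[OF that(2)] by (rule rtrancl_trans)
  then show ?thesis using assms by (auto simp: connected_graph_def lessThan_empty_iff)
qed

end

section \<open>A lower bound for the maximum\<close>

text \<open>\<open>Max\<close> is meaningful because \<open>card E\<close> bounds all
  values.\<close>

lemma card_uncrossed_le_max_uncrossed:
  assumes "finite E" "drawing V E p c"
  shows "card (uncrossed_edges E c) \<le> max_uncrossed V E"
  unfolding max_uncrossed_def
proof (rule Max_ge)
  have "{card (uncrossed_edges E c) |p c. drawing V E p c} \<subseteq> {..card E}"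
    using assms(1) by (auto simp: uncrossed_edges_def intro: card_mono)
  then show "finite {card (uncrossed_edges E c) |p c. drawing V E p c}"
    by (rule finite_subset) simp
qed (use assms(2) in blast)

lemma ex_graph_many_uncrossed:
  assumes "3 < k" "k \<le> n"
  shows "\<exists>(V :: nat set) E. simple_graph V E \<and> connected_graph V E \<and> card V = n \<and>
           2 * card E = k * (k - 1) + 6 * (n - k) \<and> 2 * (k - 1) + 3 * (n - k) \<le> max_uncrossed V E"
proof -
  define K where "K = k - 1"
  obtain x where x: "x 0 < (0 :: real)" "\<And>i. 0 < i \<Longrightarrow> i < K \<Longrightarrow> 0 < x i"
    "\<And>i j. i < j \<Longrightarrow> j < K \<Longrightarrow> x i < x j" "generic_abscissae (x ` {..<K})"
    using ex_generic_abscissae[of K] by blast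
  \<comment> \<open>The sum dominates every square, and the 1 makes it strict.\<close>
  define M where "M = 1 + (\<Sum>i<K. (x i)\<^sup>2)"
  have "(x i)\<^sup>2 < M" if "i < K" for i
    using member_le_sum[of i "{..<K}" "\<lambda>i. (x i)\<^sup>2"] that by (simp add: M_def)
  then interpret parabola_layout x K M
    using assms x by unfold_locales (auto simp: K_def)
  have n: "n = Suc K + (n - k)" and k: "k = Suc K" using assms by (auto simp: K_def)
  have fin: "finite (edges n)"
    unfolding edges_def by (intro finite_imageI finite_SigmaI) (auto simp: finite_nbrs)
  have "card (free_edges n) \<le> card (uncrossed_edges (edges n) curve)"
    using fin by (intro card_mono free_edges_uncrossed) (simp add: uncrossed_edges_def)
  also have "\<dots> \<le> max_uncrossed {..<n} (edges n)"
    by (rule card_uncrossed_le_max_uncrossed[OF fin drawing_edges])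
  finally have "2 * (k - 1) + 3 * (n - k) \<le> max_uncrossed {..<n} (edges n)"
    using card_free_edges_eq[of "n - k"] n k by simp
  moreover have "2 * card (edges n) = k * (k - 1) + 6 * (n - k)"
    using card_edges_eq[of "n - k"] n k by simp
  ultimately show ?thesis
    using simple_graph_edges[of n] connected_graph_edges[of n] assms
    by (intro exI[of _ "{..<n}"] exI[of _ "edges n"]) auto
qed

section \<open>Choosing the clique size\<close>

theorem theorem6:
  fixes n :: nat and \<epsilon> :: real
  assumes "n > 0"
    and "0 < \<epsilon>" and "\<epsilon> \<le> 1/2 - 1 / (2 * real n)"
    and "real n \<ge> 3 / \<epsilon>"
  shows "\<exists>(V :: nat set) (E :: nat set set) (m :: nat).
           simple_graph V E \<and> connected_graph V E \<and> card V = n \<and> card E = m \<and>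
           real (max_uncrossed V E) \<ge> 3 * real n - 3 - sqrt (2 * real m) \<and>
           \<epsilon> \<le> real m / (real n)\<^sup>2 \<and>
           real m / (real n)\<^sup>2 \<le> \<epsilon> + 1 / real n + 1 / (2 * (real n)\<^sup>2)"
proof -
  \<comment> \<open>\<open>T\<close> is the lower bound on the number of edges, \<open>F k\<close>
    the number of edges for a clique of size \<open>k\<close>.\<close>
  define T where "T = \<epsilon> * (real n)\<^sup>2"
  define F where "F k = (real k * (real k - 1) + 6 * (real n - real k)) / 2" for k
  have "3 \<le> \<epsilon> * real n" using assms(2,4) by (simp add: field_simps)
  then have T_lower: "3 * real n \<le> T"
    using mult_right_mono[of 3 "\<epsilon> * real n" "real n"]
    by (simp add: T_def power2_eq_square mult_ac)
  have "T \<le> (1/2 - 1 / (2 * real n)) * (real n)\<^sup>2"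
    unfolding T_def using assms(3) by (intro mult_right_mono) auto
  also have "\<dots> = real n * (real n - 1) / 2"
    using assms(1) by (simp add: power2_eq_square field_simps)
  finally have T_upper: "T \<le> real n * (real n - 1) / 2" .
  have "6 * real n \<le> real n * (real n - 1)" using T_lower T_upper by linarith
  then have "6 \<le> real n - 1" using assms(1) by simp
  then have n: "7 \<le> n" by linarith
  define k where "k = (LEAST k. 3 \<le> k \<and> T \<le> F k)"
  \<comment> \<open>For \<open>k = n\<close> the graph is complete, and so the \<open>LEAST\<close>
    exists.\<close>
  have Fn: "3 \<le> n \<and> T \<le> F n" using T_upper n by (simp add: F_def)
  then have k: "3 \<le> k" "T \<le> F k" and kn: "k \<le> n"
    using LeastI[of "\<lambda>k. 3 \<le> k \<and> T \<le> F k" n] Least_le[of "\<lambda>k. 3 \<le> k \<and> T \<le> F k" n]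
    unfolding k_def by auto
  \<comment> \<open>\<open>F 3 = 3 * n - 6\<close>. Hence \<open>k - 1\<close> is still at least 3,
    and minimality gives \<open>F (k - 1) < T\<close>.\<close>
  have "F 3 < T" using T_lower by (simp add: F_def)
  then have k3: "3 < k" using k by (cases "k = 3") auto
  have "F (k - 1) < T"
    using not_less_Least[of "k - 1" "\<lambda>k. 3 \<le> k \<and> T \<le> F k"] k3 unfolding k_def[symmetric] by auto
  \<comment> \<open>Enlarging the clique by one vertex replaces three edges by \<open>k - 1\<close>,
    so \<open>F k\<close> exceeds \<open>T\<close> by less than \<open>n\<close>.\<close>
  moreover have "F k = F (k - 1) + real k - 4"
    using k3 by (simp add: F_def of_nat_diff field_simps)
  ultimately have Fk: "F k \<le> T + real n" using kn by linarith
  obtain V :: "nat set" and E where G: "simple_graph V E" "connected_graph V E" "card V = n"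
    "2 * card E = k * (k - 1) + 6 * (n - k)" "2 * (k - 1) + 3 * (n - k) \<le> max_uncrossed V E"
    using ex_graph_many_uncrossed[OF k3 kn] by blast
  have "real (2 * card E) = real k * (real k - 1) + 6 * (real n - real k)"
    unfolding G(4) using k3 kn by (simp add: of_nat_diff)
  then have m: "real (card E) = F k" by (simp add: F_def)
  \<comment> \<open>Already \<open>k * (k - 1)\<close> is at least
    \<open>(k - 1)\<^sup>2\<close>.\<close>
  have "(real k - 1)\<^sup>2 \<le> 2 * F k"
    using k3 kn by (simp add: F_def power2_eq_square algebra_simps)
  then have "real k - 1 \<le> sqrt (2 * real (card E))"
    unfolding m by (rule real_le_rsqrt)
  moreover have "3 * real n - real k - 2 \<le> real (max_uncrossed V E)"
  proof -
    have "real (2 * (k - 1) + 3 * (n - k)) \<le> real (max_uncrossed V E)"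
      using G(5) by (simp only: of_nat_le_iff)
    then show ?thesis using k3 kn by (simp add: of_nat_diff)
  qed
  \<comment> \<open>Here \<open>3 * n - k - 2 = 3 * n - 3 - (k - 1)\<close>.\<close>
  ultimately have "3 * real n - 3 - sqrt (2 * real (card E)) \<le> real (max_uncrossed V E)"
    by linarith
  moreover have "\<epsilon> \<le> real (card E) / (real n)\<^sup>2"
    using k(2) assms(1) unfolding m T_def by (simp add: field_simps)
  moreover have "real (card E) / (real n)\<^sup>2 \<le> \<epsilon> + 1 / real n + 1 / (2 * (real n)\<^sup>2)"
  proof -
    have "F k / (real n)\<^sup>2 \<le> (T + real n) / (real n)\<^sup>2"
      using Fk by (rule divide_right_mono) simp
    also have "\<dots> = \<epsilon> + 1 / real n"
      using assms(1) by (simp add: T_def power2_eq_square field_simps)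
    finally have "F k / (real n)\<^sup>2 \<le> \<epsilon> + 1 / real n" .
    moreover have "0 \<le> 1 / (2 * (real n)\<^sup>2)" by simp
    ultimately show ?thesis unfolding m by linarith
  qed
  ultimately show ?thesis using G(1-3) by blast
qed

end
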